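(* Let $f=h+\overline{g}$ be a pluriharmonic mapping from $\mathbb{B}^n$ into $\mathbb{C}^n$ and $F=h-g$, where $h$ is locally biholomorphic and $g$ is holomorphic in $\mathbb{B}^n$. Let $M>0$ and $C$ be constants. (I) Suppose that $F$ is biholomorphic, that $\Omega=F(\mathbb{B}^n)$ is $M$-linearly connected, and that $$\|Dg(z)[Dh(z)]^{-1}\|\le C<\frac{1}{2M+1}\quad\text{for all } z\in\mathbb{B}^n.$$ Then for every $A\in L(\mathbb{C}^n,\mathbb{C}^n)$ with $\|A\|\le 1$, the mapping $f_A=h+\overline{g}A$ is univalent and $f_A(\mathbb{B}^n)$ is $M'$-linearly connected, where $M'=\frac{M(1+C)}{1-(1+2M)C}$. In particular, $h+g$ is in SBH. (II) Suppose that $f$ is univalent, that $\Omega=f(\mathbb{B}^n)$ is $M$-linearly connected, and that $$\|Dg(z)[Dh(z)]^{-1}\|\le C<\frac{1}{2M+1}\quad\text{for all } z\in\mathbb{B}^n.$$ Then for every $A\in L(\mathbb{C}^n,\mathbb{C}^n)$ with $\|A\|\le 1$, the mapping $F_A=h-gA$ is univalent and $F_A(\mathbb{B}^n)$ is $M'$-linearly connected, where $M'=\frac{M(1+C)}{1-(1+2M)C}$. In particular, $h+\overline{g}$ belongs to SPU.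
   Context: $\mathbb{B}^n$ is the open unit ball of $\mathbb{C}^n$ with respect to the Euclidean norm $\|z\|=\langle z,z\rangle^{1/2}$. For a complex $n\times n$ matrix $A$ (an element of $L(\mathbb{C}^n,\mathbb{C}^n)$), $\|A\|=\sup_{z\ne 0}\|Az\|/\|z\|$ is the operator norm. For a holomorphic mapping $h=(h_1,\ldots,h_n)$ on $\mathbb{B}^n$, $Dh$ is the $n\times n$ matrix whose $j$-th row is $(\partial h_j/\partial z_1,\ldots,\partial h_j/\partial z_n)$; $Dg$ is defined in the same way. For $w=(w_1,\ldots,w_n)$, $\overline{w}=(\overline{w}_1,\ldots,\overline{w}_n)$. Values of mappings into $\mathbb{C}^n$ are written as row vectors in products with matrices on the right: $gA$ is the mapping $z\mapsto g(z)A$ and $\overline{g}A$ is the mapping $z\mapsto \overline{g(z)}A$. A mapping $f:\mathbb{B}^n\to\mathbb{C}^n$ is pluriharmonic if and only if $f=h+\overline{g}$ with $h,g$ holomorphic. "Univalent" means injective. "Biholomorphic in $\mathbb{B}^n$" means holomorphic, injective, with holomorphic inverse on the image; "locally biholomorphic" means that $Dh(z)$ is invertible for every $z$. A domain $D\subset\mathbb{C}^n$ is $M$-linearly connected (for a positive constant $M<\infty$) if any two points $w_1,w_2\in D$ are joined by a path $\gamma\subset D$ with $\ell(\gamma)\le M\|w_1-w_2\|$, where $\ell(\gamma)=\int_\gamma\|dz\|$ is the length of $\gamma$. Definitions (for given holomorphic $h,g:\mathbb{B}^n\to\mathbb{C}^n$): $f=h+\overline{g}$ is in SPU (stable pluriharmonic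 univalent) if for every $A\in L(\mathbb{C}^n,\mathbb{C}^n)$ with $\|A\|=1$ the mapping $h+\overline{g}A$ is univalent in $\mathbb{B}^n$; $h+g$ is in SBH (stable biholomorphic) if for every $A\in L(\mathbb{C}^n,\mathbb{C}^n)$ with $\|A\|=1$ the mapping $h+gA$ is biholomorphic in $\mathbb{B}^n$. *)

theory Defs
  imports "HOL-Analysis.Analysis"
begin

text \<open>The norm of \<^typ>\<open>complex^'n\<close> is the Hermitian one, so \<^term>\<open>ball 0 1\<close> is the Euclidean
  unit ball, and the operator norm of a matrix \<^term>\<open>A\<close> is \<^term>\<open>onorm ((*v) A)\<close>.\<close>

definition cnj_vec :: "complex^'n \<Rightarrow> complex^'n" where
  "cnj_vec w = (\<chi> j. cnj (w $ j))"

text \<open>Several-variable holomorphy is not in the library. Here it is complex Frechet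
  differentiability on an open set: the derivative is given by a complex matrix.\<close>

definition holomorphic_map_on ::
    "(complex^'n \<Rightarrow> complex^'m) \<Rightarrow> (complex^'n) set \<Rightarrow> bool" where
  "holomorphic_map_on f S \<longleftrightarrow>
     open S \<and> (\<forall>z\<in>S. \<exists>L :: complex^'n^'m. (f has_derivative (*v) L) (at z))"

definition jacobian_matrix ::
    "(complex^'n \<Rightarrow> complex^'m) \<Rightarrow> complex^'n \<Rightarrow> complex^'n^'m" where
  "jacobian_matrix f z =
     (\<chi> j k. deriv (\<lambda>\<zeta>. f (\<chi> l. if l = k then \<zeta> else z $ l) $ j) (z $ k))"

definition locally_biholomorphic_on ::
    "(complex^'n \<Rightarrow> complex^'n) \<Rightarrow> (complex^'n) set \<Rightarrow> bool" where
  "locally_biholomorphic_on f S \<longleftrightarrow>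
     holomorphic_map_on f S \<and> (\<forall>z\<in>S. invertible (jacobian_matrix f z))"

text \<open>Openness of the image is part of the holomorphy of the inverse.\<close>

definition biholomorphic_on ::
    "(complex^'n \<Rightarrow> complex^'n) \<Rightarrow> (complex^'n) set \<Rightarrow> bool" where
  "biholomorphic_on f S \<longleftrightarrow>
     holomorphic_map_on f S \<and> inj_on f S \<and> holomorphic_map_on (the_inv_into S f) (f ` S)"

definition pluriharmonic_on ::
    "(complex^'n \<Rightarrow> complex^'n) \<Rightarrow> (complex^'n) set \<Rightarrow> bool" where
  "pluriharmonic_on f S \<longleftrightarrow>
     (\<exists>h g. holomorphic_map_on h S \<and> holomorphic_map_on g S \<and>
            (\<forall>z\<in>S. f z = h z + cnj_vec (g z)))"

text \<open>The length of a piecewise continuously differentiable path as the integral of its speed.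
  This is a relation rather than an integral term because \<^const>\<open>valid_path\<close> admits paths with
  non-integrable speed, for which \<^const>\<open>integral\<close> would be 0.\<close>

definition has_path_length :: "(real \<Rightarrow> 'a::real_normed_vector) \<Rightarrow> real \<Rightarrow> bool" where
  "has_path_length \<gamma> l \<longleftrightarrow>
     valid_path \<gamma> \<and> ((\<lambda>t. norm (vector_derivative \<gamma> (at t))) has_integral l) {0..1}"

definition linearly_connected :: "real \<Rightarrow> (complex^'n) set \<Rightarrow> bool" where
  "linearly_connected M D \<longleftrightarrow>
     M > 0 \<and> open D \<and> connected D \<and> D \<noteq> {} \<and>
     (\<forall>w1\<in>D. \<forall>w2\<in>D. \<exists>\<gamma> l. has_path_length \<gamma> l \<and> pathstart \<gamma> = w1 \<and> pathfinish \<gamma> = w2 \<and>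
        path_image \<gamma> \<subseteq> D \<and> l \<le> M * norm (w1 - w2))"

text \<open>The two stable classes are stated for the pair \<^term>\<open>(h, g)\<close>; \<open>v*\<close> multiplies a row vector
  by a matrix on the right.\<close>

definition stable_pluriharmonic_univalent ::
    "(complex^'n \<Rightarrow> complex^'n) \<Rightarrow> (complex^'n \<Rightarrow> complex^'n) \<Rightarrow> bool" where
  "stable_pluriharmonic_univalent h g \<longleftrightarrow>
     (\<forall>A :: complex^'n^'n. onorm ((*v) A) = 1 \<longrightarrow>
        inj_on (\<lambda>z. h z + cnj_vec (g z) v* A) (ball 0 1))"

definition stable_biholomorphic ::
    "(complex^'n \<Rightarrow> complex^'n) \<Rightarrow> (complex^'n \<Rightarrow> complex^'n) \<Rightarrow> bool" where
  "stable_biholomorphic h g \<longleftrightarrow>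
     (\<forall>A :: complex^'n^'n. onorm ((*v) A) = 1 \<longrightarrow>
        biholomorphic_on (\<lambda>z. h z + g z v* A) (ball 0 1))"

end

theory Submission
  imports Defs "HOL-Complex_Analysis.Cauchy_Integral_Formula"
begin

text \<open>Both parts are the same statement about real-linear contractions. For real-linear \<open>P\<close>, \<open>Q\<close> on
\<open>\<complex>\<^sup>n\<close> that do not increase the norm, put \<open>p = h + P \<circ> g\<close> and \<open>q = h + Q \<circ> g\<close>. If \<open>p\<close> is injective
with \<open>M\<close>-linearly connected image, then so is \<open>q\<close>, with the constant \<open>M'\<close>. Part (I) is \<open>P v = - v\<close>
with \<open>Q v = cnj v A\<close>, or \<open>Q v = v A\<close> for the stable class; part (II) is \<open>P v = cnj v\<close> with
\<open>Q v = - v A\<close>, or \<open>Q v = cnj v A\<close> for the stable class. Right multiplication by \<open>A\<close> is a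
contraction because \<open>A\<close> and its transpose have the same operator norm.

The reason is a comparison of speeds. Let \<open>\<gamma>\<close> be a path of length \<open>l\<close> from \<open>p z1\<close> to \<open>p z2\<close> in the
image of \<open>p\<close> and let \<open>\<delta> = p\<inverse> \<circ> \<gamma>\<close>. With \<open>s = Dh(\<delta>) \<delta>'\<close> and \<open>\<omega> = Dg (Dh)\<inverse>\<close>, the derivatives of
\<open>\<gamma>\<close>, \<open>q \<circ> \<delta>\<close> and \<open>g \<circ> \<delta>\<close> are \<open>s + P (\<omega> s)\<close>, \<open>s + Q (\<omega> s)\<close> and \<open>\<omega> s\<close>. As \<open>\<omega>\<close> has norm at most \<open>C\<close>,
\<open>(1 - C) \<parallel>s\<parallel> \<le> \<parallel>\<gamma>'\<parallel>\<close>; hence \<open>q \<circ> \<delta>\<close> has length at most \<open>(1 + C) l / (1 - C)\<close>, and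
\<open>\<parallel>g z1 - g z2\<parallel> \<le> C l / (1 - C)\<close>. Choosing \<open>l \<le> M \<parallel>p z1 - p z2\<parallel>\<close> and writing
\<open>q = p - P \<circ> g + Q \<circ> g\<close> gives
\<open>(1 - (1 + 2M) C) \<parallel>p z1 - p z2\<parallel> \<le> (1 - C) \<parallel>q z1 - q z2\<parallel>\<close>, so \<open>q\<close> is injective, and combining this
with the length bound yields \<open>M'\<close>. This is \<open>transport_path\<close> followed by
\<open>linearly_connected_perturbation\<close>.

Two points need care. Images are open, and inverses continuous, by invariance of domain. And
\<open>q \<circ> \<delta>\<close> has to be piecewise continuously differentiable, which rests on the continuity of \<open>Dh\<close> and
\<open>Dg\<close>; complex differentiability gives this through Cauchy's inequality on complex lines
(\<open>continuous_on_jacobian_matrix\<close>).\<close>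

section \<open>Conjugation and right multiplication by a matrix\<close>

lemma norm_cnj_vec: "norm (cnj_vec x) = norm x"
  by (simp add: cnj_vec_def norm_vec_def)

lemma bounded_linear_cnj_vec: "bounded_linear cnj_vec"
  by (rule bounded_linear_intro[where K = 1])
    (simp_all add: norm_cnj_vec, simp_all add: cnj_vec_def vec_eq_iff)

text \<open>Right multiplication by \<open>A\<close> is the adjoint of left multiplication by \<open>A\<close>, up to conjugating vectors
on both sides; so the two have the same operator norm.\<close>

lemma norm_vector_matrix_mult_le:
  fixes A :: "complex^'n^'m"
  shows "norm (w v* A) \<le> onorm ((*v) A) * norm w"
proof -
  define u where "u = w v* A"
  \<comment> \<open>The real inner product is the real part of the Hermitian one.\<close>
  have "u \<bullet> u = Re (\<Sum>j\<in>UNIV. u $ j * cnj (u $ j))"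
    by (simp add: inner_vec_def inner_complex_def)
  also have "\<dots> = Re (\<Sum>j\<in>UNIV. \<Sum>i\<in>UNIV. w $ i * (A $ i $ j * cnj (u $ j)))"
    by (simp add: u_def vector_matrix_mult_def sum_distrib_right mult_ac)
  also have "\<dots> = Re (\<Sum>i\<in>UNIV. w $ i * (A *v cnj_vec u) $ i)"
    by (subst sum.swap) (simp add: matrix_vector_mult_def cnj_vec_def sum_distrib_left)
  also have "\<dots> = cnj_vec w \<bullet> (A *v cnj_vec u)"
    by (simp add: inner_vec_def inner_complex_def cnj_vec_def)
  also have "\<dots> \<le> norm w * norm (A *v cnj_vec u)"
    using norm_cauchy_schwarz norm_cnj_vec by metis
  also have "\<dots> \<le> norm w * (onorm ((*v) A) * norm u)"
    using onorm[OF matrix_vector_mul_bounded_linear, of A "cnj_vec u"]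
    by (intro mult_left_mono) (auto simp: norm_cnj_vec)
  finally have "norm u * norm u \<le> (onorm ((*v) A) * norm w) * norm u"
    by (simp add: dot_square_norm power2_eq_square mult_ac)
  then have "norm u \<le> onorm ((*v) A) * norm w"
    by (cases "norm u = 0") (auto intro!: mult_nonneg_nonneg onorm_pos_le simp: mult_le_cancel_right)
  then show ?thesis by (simp add: u_def)
qed

lemma norm_vector_matrix_mult_contraction:
  fixes A :: "complex^'n^'m"
  assumes "onorm ((*v) A) \<le> 1"
  shows "norm (w v* A) \<le> norm w"
  using norm_vector_matrix_mult_le[of w A] mult_right_mono[OF assms, of "norm w"] by simp

lemma bounded_linear_vector_matrix_mult: "bounded_linear (\<lambda>w. w v* A)" for A :: "complex^'n^'m"
  using matrix_vector_mul_bounded_linear[of "transpose A"] unfolding transpose_matrix_vector .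

section \<open>Jacobian matrices of holomorphic maps\<close>

lemma norm_axis: "norm (axis k x) = norm (x :: 'a::real_inner)"
  by (simp add: norm_eq_sqrt_inner inner_axis_axis)

lemma bounded_linear_axis: "bounded_linear (axis k :: 'a::real_inner \<Rightarrow> 'a^'n)"
proof (rule bounded_linear_intro[where K = 1])
  show "norm (axis k x :: 'a^'n) \<le> norm x * 1" for x :: 'a
    by (simp add: norm_axis)
qed (auto simp: axis_def vec_eq_iff)

lemma has_field_derivative_along_axis:
  fixes f :: "complex^'n \<Rightarrow> complex^'m"
  assumes "(f has_derivative (*v) L) (at (z + axis k \<zeta>))"
  shows "((\<lambda>\<zeta>. f (z + axis k \<zeta>) $ j) has_field_derivative L $ j $ k) (at \<zeta>)"
proof -
  have axis': "((\<lambda>\<zeta>. z + axis k \<zeta>) has_derivative axis k) (at \<zeta>)"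
    by (auto intro!: derivative_eq_intros bounded_linear_imp_has_derivative bounded_linear_axis)
  have "((\<lambda>\<zeta>. f (z + axis k \<zeta>)) has_derivative (\<lambda>\<zeta>. L *v axis k \<zeta>)) (at \<zeta>)"
    using diff_chain_at[OF axis', of f] assms by (simp add: o_def)
  from bounded_linear.has_derivative[OF bounded_linear_vec_nth this]
  have "((\<lambda>\<zeta>. f (z + axis k \<zeta>) $ j) has_derivative (\<lambda>\<zeta>. (L *v axis k \<zeta>) $ j)) (at \<zeta>)" .
  moreover have "(L *v axis k \<zeta>) $ j = L $ j $ k * \<zeta>" for \<zeta>
    by (simp add: matrix_vector_mult_def axis_def if_distrib cong: if_cong)
  ultimately show ?thesis
    by (simp add: has_field_derivative_def)
qed

text \<open>Complex Frechet differentiability implies that all partial derivatives exist, so the matrix of the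
differential is the Jacobian matrix.\<close>

lemma jacobian_matrix_eqI:
  fixes f :: "complex^'n \<Rightarrow> complex^'m"
  assumes "(f has_derivative (*v) L) (at z)"
  shows "jacobian_matrix f z = L"
proof -
  have slice: "(\<chi> l. if l = k then \<zeta> else z $ l) = (z - axis k (z $ k)) + axis k \<zeta>" for k \<zeta>
    by (simp add: vec_eq_iff axis_def)
  have "((\<lambda>\<zeta>. f (\<chi> l. if l = k then \<zeta> else z $ l) $ j) has_field_derivative L $ j $ k)
      (at (z $ k))" for j k
    unfolding slice by (rule has_field_derivative_along_axis) (simp add: assms)
  then show ?thesis
    by (simp add: jacobian_matrix_def vec_eq_iff DERIV_imp_deriv)
qed

lemma holomorphic_map_on_jacobian_matrix:
  assumes "holomorphic_map_on f S" "z \<in> S"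
  shows "(f has_derivative (*v) (jacobian_matrix f z)) (at z)"
  using assms jacobian_matrix_eqI unfolding holomorphic_map_on_def by metis

lemma holomorphic_map_on_imp_continuous_on:
  assumes "holomorphic_map_on f S"
  shows "continuous_on S f"
  using holomorphic_map_on_jacobian_matrix[OF assms]
  by (meson continuous_at_imp_continuous_on has_derivative_continuous)

text \<open>A holomorphic map is continuously differentiable. A partial derivative at \<open>z\<close> minus the one at \<open>a\<close> is
the derivative at \<open>0\<close> of the one-variable function \<open>\<phi> z - \<phi> a\<close>, the difference of the restrictions to
parallel complex lines. Cauchy's inequality bounds it by the size of \<open>\<phi> z - \<phi> a\<close> on a circle of fixed
radius, and this is small by uniform continuity.\<close>

lemma continuous_on_jacobian_matrix:
  fixes f :: "complex^'n \<Rightarrow> complex^'m"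
  assumes f: "holomorphic_map_on f S"
  shows "continuous_on S (jacobian_matrix f)"
proof -
  have entry: "((\<lambda>z. jacobian_matrix f z $ j $ k) \<longlongrightarrow> jacobian_matrix f a $ j $ k) (at a)" if "a \<in> S" for a j k
  proof -
    have "open S" using f by (simp add: holomorphic_map_on_def)
    then obtain R where R: "R > 0" "cball a R \<subseteq> S"
      using \<open>a \<in> S\<close> open_contains_cball by blast
    \<comment> \<open>Half the radius, so that circles of radius \<open>r\<close> around all points near \<open>a\<close> stay in the compact ball.\<close>
    define r where "r = R / 2"
    have r: "r > 0" "R = r + r" using R by (auto simp: r_def)
    define \<phi> where "\<phi> = (\<lambda>z \<zeta>. f (z + axis k \<zeta>) $ j)"
    have inS: "z + axis k \<zeta> \<in> cball a R" if "dist z a < r" "norm \<zeta> \<le> r" for z \<zeta>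
      using that norm_triangle_ineq[of "z - a" "axis k \<zeta>"]
      by (simp add: dist_norm norm_axis r norm_minus_commute algebra_simps)
    have \<phi>': "(\<phi> z has_field_derivative jacobian_matrix f (z + axis k \<zeta>) $ j $ k) (at \<zeta>)"
      if "z + axis k \<zeta> \<in> S" for z \<zeta>
      unfolding \<phi>_def
      by (rule has_field_derivative_along_axis[OF holomorphic_map_on_jacobian_matrix[OF f that]])
    have ax0: "axis k 0 = (0::complex^'n)" by (simp add: axis_def vec_eq_iff)
    have bound: "norm (jacobian_matrix f z $ j $ k - jacobian_matrix f a $ j $ k) \<le> e / r"
      if z: "dist z a < r" and e: "\<And>\<zeta>. norm \<zeta> = r \<Longrightarrow> norm (\<phi> z \<zeta> - \<phi> a \<zeta>) \<le> e" for z e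
    proof -
      have d: "((\<lambda>\<zeta>. \<phi> z \<zeta> - \<phi> a \<zeta>) has_field_derivative
            jacobian_matrix f (z + axis k \<zeta>) $ j $ k - jacobian_matrix f (a + axis k \<zeta>) $ j $ k) (at \<zeta>)"
        if "norm \<zeta> \<le> r" for \<zeta>
        using inS[OF z that] inS[of a \<zeta>] that R r by (intro DERIV_diff \<phi>') auto
      then have "(\<lambda>\<zeta>. \<phi> z \<zeta> - \<phi> a \<zeta>) holomorphic_on cball 0 r"
        by (intro holomorphic_onI) (auto simp: field_differentiable_def dist_norm intro: has_field_derivative_at_within)
      then have "norm ((deriv ^^ 1) (\<lambda>\<zeta>. \<phi> z \<zeta> - \<phi> a \<zeta>) 0) \<le> fact 1 * e / r ^ 1"
        using e r by (intro Cauchy_inequality holomorphic_on_imp_continuous_on)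
           (auto elim: holomorphic_on_subset)
      then show ?thesis using DERIV_imp_deriv[OF d[of 0]] r by (simp add: ax0)
    qed
    have "uniformly_continuous_on (cball a R) f"
      using continuous_on_subset[OF holomorphic_map_on_imp_continuous_on[OF f] R(2)]
      by (simp add: compact_uniformly_continuous)
    show ?thesis
    proof (rule tendstoI)
      fix e :: real assume "e > 0"
      then have "e * r / 2 > 0" using r by simp
      with \<open>uniformly_continuous_on (cball a R) f\<close> obtain d where "d > 0"
        and d: "\<And>x y. x \<in> cball a R \<Longrightarrow> y \<in> cball a R \<Longrightarrow> dist y x < d \<Longrightarrow> dist (f y) (f x) < e * r / 2"
        unfolding uniformly_continuous_on_def by meson
      have "dist (jacobian_matrix f z $ j $ k) (jacobian_matrix f a $ j $ k) < e" if "dist z a < min d r" for z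
      proof -
        have "norm (\<phi> z \<zeta> - \<phi> a \<zeta>) \<le> e * r / 2" if "norm \<zeta> = r" for \<zeta>
        proof -
          have "dist (f (z + axis k \<zeta>)) (f (a + axis k \<zeta>)) < e * r / 2"
            using \<open>dist z a < min d r\<close> that r by (intro d inS) (auto simp: dist_norm)
          then show ?thesis
            using Finite_Cartesian_Product.norm_nth_le[of "f (z + axis k \<zeta>) - f (a + axis k \<zeta>)" j]
            by (auto simp: \<phi>_def dist_norm)
        qed
        from bound[OF _ this] that show ?thesis using \<open>e > 0\<close> r by (simp add: dist_norm)
      qed
      then show "\<forall>\<^sub>F z in at a. dist (jacobian_matrix f z $ j $ k) (jacobian_matrix f a $ j $ k) < e"
        unfolding eventually_at using \<open>d > 0\<close> r(1) by (intro exI[of _ "min d r"]) auto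
    qed
  qed
  show ?thesis
    by (intro continuous_at_imp_continuous_on ballI)
      (auto simp: isCont_def intro!: vec_tendstoI entry)
qed

section \<open>Matrices depending continuously on a parameter\<close>

lemma matrix_inv_works:
  assumes "invertible A"
  shows "A ** matrix_inv A = mat 1" "matrix_inv A ** A = mat 1"
  using someI_ex[OF assms[unfolded invertible_def]] by (auto simp: matrix_inv_def)

lemma continuous_on_matrix_entries:
  fixes A :: "'t::topological_space \<Rightarrow> ('a::topological_space)^'n^'m"
  shows "continuous_on S A \<longleftrightarrow> (\<forall>i j. continuous_on S (\<lambda>t. A t $ i $ j))"
proof
  assume "continuous_on S A"
  then show "\<forall>i j. continuous_on S (\<lambda>t. A t $ i $ j)"
    by (auto intro!: continuous_on_component)
next
  assume "\<forall>i j. continuous_on S (\<lambda>t. A t $ i $ j)"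
  then have "continuous_on S (\<lambda>t. \<chi> i. \<chi> j. A t $ i $ j)"
    by (intro continuous_on_vec_lambda) auto
  then show "continuous_on S A" by simp
qed

lemma continuous_on_matrix_vector_mult:
  fixes A :: "'t::topological_space \<Rightarrow> complex^'n^'m"
  assumes "continuous_on S A" "continuous_on S x"
  shows "continuous_on S (\<lambda>t. A t *v x t)"
  unfolding matrix_vector_mult_def
  by (intro continuous_on_vec_lambda continuous_on_sum continuous_on_mult continuous_on_component assms)

lemma continuous_on_matrix_matrix_mult:
  fixes A :: "'t::topological_space \<Rightarrow> complex^'n^'m" and B :: "'t \<Rightarrow> complex^'k^'n"
  assumes "continuous_on S A" "continuous_on S B"
  shows "continuous_on S (\<lambda>t. A t ** B t)"
  unfolding matrix_matrix_mult_def
  by (intro continuous_on_vec_lambda continuous_on_sum continuous_on_mult continuous_on_component assms)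

lemma continuous_on_det:
  fixes A :: "'t::topological_space \<Rightarrow> complex^'n^'n"
  assumes "continuous_on S A"
  shows "continuous_on S (\<lambda>t. det (A t))"
  unfolding det_def
  by (intro continuous_on_sum continuous_on_mult continuous_on_prod continuous_on_const
      continuous_on_component assms)

text \<open>By Cramer's rule the entries of the inverse are quotients of determinants.\<close>

lemma continuous_on_matrix_inv:
  fixes A :: "'t::topological_space \<Rightarrow> complex^'n^'n"
  assumes A: "continuous_on S A" and inv: "\<And>t. t \<in> S \<Longrightarrow> invertible (A t)"
  shows "continuous_on S (\<lambda>t. matrix_inv (A t))"
proof -
  define D where "D = (\<lambda>k j t. det (\<chi> i m. if m = k then axis j 1 $ i else A t $ i $ m) :: complex)"
  have "continuous_on S (D k j)" for k j
  proof -
    have "continuous_on S (\<lambda>t. if m = k then axis j 1 $ i else A t $ i $ m)" for i m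
      using A by (cases "m = k") (auto simp: continuous_on_matrix_entries)
    then show ?thesis
      unfolding D_def by (intro continuous_on_det) (simp add: continuous_on_matrix_entries)
  qed
  then have "continuous_on S (\<lambda>t. D k j t / det (A t))" for k j
    using inv by (intro continuous_on_divide continuous_on_det A) (auto simp: invertible_det_nz)
  moreover have "matrix_inv (A t) $ k $ j = D k j t / det (A t)" if "t \<in> S" for t k j
  proof -
    have "A t *v (matrix_inv (A t) *v axis j 1) = axis j 1"
      using matrix_inv_works[OF inv[OF that]] by (simp add: matrix_vector_mul_assoc)
    then have "matrix_inv (A t) *v axis j 1 = (\<chi> k. D k j t / det (A t))"
      using cramer[of "A t"] inv[OF that] by (simp add: invertible_det_nz D_def)
    moreover have "(matrix_inv (A t) *v axis j 1) $ k = matrix_inv (A t) $ k $ j"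
      by (simp add: matrix_vector_mult_def axis_def if_distrib cong: if_cong)
    ultimately show ?thesis by simp
  qed
  ultimately show ?thesis
    unfolding continuous_on_matrix_entries by (auto cong: continuous_on_cong)
qed

section \<open>Inverses of injective maps\<close>

lemma continuous_on_the_inv_into:
  fixes f :: "'a::euclidean_space \<Rightarrow> 'a"
  assumes "open S" "continuous_on S f" "inj_on f S"
  shows "continuous_on (f ` S) (the_inv_into S f)"
  using assms by (intro continuous_on_inverse_open) (auto simp: the_inv_into_f_f)

lemma has_derivative_the_inv_into:
  fixes f :: "'a::euclidean_space \<Rightarrow> 'a"
  assumes "open S" "continuous_on S f" "inj_on f S" "z \<in> S"
    and "(f has_derivative f') (at z)" "bounded_linear g'" "g' \<circ> f' = id"
  shows "(the_inv_into S f has_derivative g') (at (f z))"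
  using assms
  by (intro has_derivative_inverse_dieudonne[of S f _ z] invariance_of_domain
      continuous_on_the_inv_into) (auto simp: the_inv_into_f_f)

section \<open>Lengths of paths\<close>

text \<open>A bound for the speed also shows that the length exists: the speed is continuous off a finite set, hence
measurable, and measurable functions dominated by an integrable one are integrable.\<close>

lemma has_path_length_dominated:
  fixes \<gamma> :: "real \<Rightarrow> 'a::euclidean_space"
  assumes \<gamma>: "continuous_on {0..1} \<gamma>" and S: "finite S"
    and \<gamma>': "\<And>t. t \<in> {0..1} - S \<Longrightarrow> (\<gamma> has_vector_derivative \<gamma>' t) (at t)"
    and cont: "continuous_on ({0..1} - S) \<gamma>'"
    and le: "\<And>t. t \<in> {0..1} - S \<Longrightarrow> norm (\<gamma>' t) \<le> m t"
    and m: "(m has_integral l) {0..1}"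
  obtains l' where "has_path_length \<gamma> l'" "l' \<le> l"
proof -
  let ?X = "{0..1::real} - S"
  have null: "negligible {t \<in> ?X - {0..1}. P t}" "negligible {t \<in> {0..1} - ?X. P t}" for P
    using S by (auto intro: negligible_subset[OF negligible_finite[OF S]])
  have spike: "(u has_integral i) ?X \<longleftrightarrow> (u has_integral i) {0..1}" for u :: "real \<Rightarrow> real" and i
    by (rule has_integral_spike_set_eq) (rule null)+
  have mX: "(m has_integral l) ?X"
    using m spike by blast
  have X: "?X \<in> sets lebesgue"
    using S by (intro sets.Diff sets_completionI_sets) (auto intro!: borel_closed finite_imp_closed)
  have "(\<lambda>t. norm (\<gamma>' t)) integrable_on ?X"
  proof (rule measurable_bounded_by_integrable_imp_integrable_real)
    show "(\<lambda>t. norm (\<gamma>' t)) \<in> borel_measurable (lebesgue_on ?X)"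
      by (intro continuous_imp_measurable_on_sets_lebesgue continuous_on_norm cont X)
  qed (use mX le X in auto)
  then obtain l' where l': "((\<lambda>t. norm (\<gamma>' t)) has_integral l') ?X"
    by blast
  \<comment> \<open>On \<open>S\<close> the path need not be differentiable, but a finite set does not affect the integral.\<close>
  have "((\<lambda>t. norm (vector_derivative \<gamma> (at t))) has_integral l') {0..1}"
    using l'[unfolded spike]
    by (rule has_integral_spike_finite[OF S, rotated]) (simp add: vector_derivative_at[OF \<gamma>'])
  moreover have "valid_path \<gamma>"
    unfolding valid_path_def piecewise_C1_differentiable_on_def C1_differentiable_on_def
    using \<gamma> S \<gamma>' cont by blast
  moreover have "l' \<le> l"
    using l' mX le by (rule has_integral_le)
  ultimately show ?thesis
    using that by (simp add: has_path_length_def)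
qed

lemma dist_endpoints_le_path_length:
  fixes \<gamma> :: "real \<Rightarrow> 'a::euclidean_space"
  assumes "has_path_length \<gamma> l"
  shows "norm (\<gamma> 1 - \<gamma> 0) \<le> l"
proof -
  obtain S where S: "finite S" "continuous_on {0..1} \<gamma>"
      "\<And>t. t \<in> {0..1} - S \<Longrightarrow> \<gamma> differentiable (at t)"
    and l: "((\<lambda>t. norm (vector_derivative \<gamma> (at t))) has_integral l) {0..1}"
    using assms unfolding has_path_length_def valid_path_def piecewise_C1_differentiable_on_def
      C1_differentiable_on_eq by blast
  have "((\<lambda>t. vector_derivative \<gamma> (at t)) has_integral \<gamma> 1 - \<gamma> 0) {0..1}"
    using S by (intro fundamental_theorem_of_calculus_interior_strong[OF S(1)])
      (auto simp: vector_derivative_works[symmetric])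
  with l show ?thesis
    using integral_norm_bound_integral[of "\<lambda>t. vector_derivative \<gamma> (at t)" "{0..1}"
        "\<lambda>t. norm (vector_derivative \<gamma> (at t))"]
    by (simp add: has_integral_iff)
qed

section \<open>Perturbations of a locally biholomorphic map\<close>

text \<open>For \<open>y = \<gamma>'\<close>, \<open>s = Dh(\<delta>) \<delta>'\<close> and \<open>N\<close> the dilatation along \<open>\<delta>\<close>, this makes the derivative of
the lifted path \<open>\<delta>\<close> inherit continuity from \<open>\<gamma>'\<close>. If \<open>s a\<close> is substituted into the equation at
\<open>t\<close>, the residual \<open>r t\<close> tends to \<open>0\<close> as \<open>t\<close> tends to \<open>a\<close>; since \<open>v \<mapsto> P (N t v)\<close> shrinks norms by the
factor \<open>C < 1\<close>, the residual controls \<open>s t - s a\<close>.\<close>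

lemma continuous_on_solution_of_contractive_equation:
  fixes s y :: "'t::topological_space \<Rightarrow> complex^'n" and N :: "'t \<Rightarrow> complex^'n^'n"
  assumes P: "bounded_linear P" "\<And>v. norm (P v) \<le> norm v"
    and N: "continuous_on X N" "\<And>t u. t \<in> X \<Longrightarrow> norm (N t *v u) \<le> C * norm u" and "C < 1"
    and y: "continuous_on X y" and eq: "\<And>t. t \<in> X \<Longrightarrow> s t + P (N t *v s t) = y t"
  shows "continuous_on X s"
  unfolding continuous_on_def
proof
  fix a assume a: "a \<in> X"
  interpret P: bounded_linear P by fact
  define r where "r = (\<lambda>t. y t - s a - P (N t *v s a))"
  have "continuous_on X r"
    unfolding r_def
    by (intro continuous_intros P.continuous_on continuous_on_matrix_vector_mult N y)
  then have "(r \<longlongrightarrow> r a) (at a within X)"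
    using a by (simp add: continuous_on_def)
  then have "(r \<longlongrightarrow> 0) (at a within X)"
    using eq[OF a] by (simp add: r_def algebra_simps)
  then have "((\<lambda>t. norm (r t) / (1 - C)) \<longlongrightarrow> 0) (at a within X)"
    using tendsto_divide[OF tendsto_norm_zero tendsto_const, of r "at a within X" "1 - C"] \<open>C < 1\<close> by simp
  moreover
  have "norm (s t - s a) \<le> norm (r t) / (1 - C)" if "t \<in> X" for t
  proof -
    have "r t = (s t - s a) + P (N t *v (s t - s a))"
      unfolding r_def eq[OF that, symmetric] by (simp add: matrix_vector_mult_diff_distrib P.diff)
    moreover have "norm (P (N t *v (s t - s a))) \<le> C * norm (s t - s a)"
      using P(2) N(2)[OF that] order_trans by blast
    ultimately have "(1 - C) * norm (s t - s a) \<le> norm (r t)"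
      using norm_diff_ineq[of "s t - s a" "P (N t *v (s t - s a))"] by (simp only: left_diff_distrib)
    then show ?thesis using \<open>C < 1\<close> by (simp add: pos_le_divide_eq mult.commute)
  qed
  then have "\<forall>\<^sub>F t in at a within X. norm (s t - s a) \<le> norm (r t) / (1 - C)"
    by (simp add: eventually_at_filter)
  ultimately have "((\<lambda>t. s t - s a) \<longlongrightarrow> 0) (at a within X)"
    by (rule Lim_null_comparison[rotated])
  then show "(s \<longlongrightarrow> s a) (at a within X)"
    by (simp add: LIM_zero_iff)
qed

locale small_dilatation =
  fixes h g :: "complex^'n \<Rightarrow> complex^'n" and U :: "(complex^'n) set" and C :: real
  assumes h: "locally_biholomorphic_on h U"
    and g: "holomorphic_map_on g U"
    and dilatation_le: "\<And>z. z \<in> U \<Longrightarrow>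
      onorm ((*v) (jacobian_matrix g z ** matrix_inv (jacobian_matrix h z))) \<le> C"
    and C_less_1: "C < 1"
begin

text \<open>Expressing \<open>Dg\<close> through \<open>Dh\<close> makes \<open>Dh v\<close> the natural variable: every derivative below is a
perturbation of the identity applied to \<open>Dh v\<close>.\<close>

definition dilatation :: "complex^'n \<Rightarrow> complex^'n^'n" where
  "dilatation z = jacobian_matrix g z ** matrix_inv (jacobian_matrix h z)"

lemma holomorphic_h: "holomorphic_map_on h U"
  and invertible_jacobian_h: "z \<in> U \<Longrightarrow> invertible (jacobian_matrix h z)"
  using h by (auto simp: locally_biholomorphic_on_def)

lemma open_U: "open U"
  using g by (simp add: holomorphic_map_on_def)

lemma norm_dilatation_mult_le:
  assumes "z \<in> U"
  shows "norm (dilatation z *v u) \<le> C * norm u"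
  using onorm[OF matrix_vector_mul_bounded_linear, of "dilatation z" u]
    mult_right_mono[OF dilatation_le[OF assms], of "norm u"]
  by (simp add: dilatation_def)

lemma C_nonneg:
  assumes "U \<noteq> {}"
  shows "0 \<le> C"
  using assms dilatation_le onorm_pos_le[OF matrix_vector_mul_bounded_linear] order_trans by blast

lemma jacobian_g_eq:
  assumes "z \<in> U"
  shows "jacobian_matrix g z *v v = dilatation z *v (jacobian_matrix h z *v v)"
  using matrix_inv_works(2)[OF invertible_jacobian_h[OF assms]]
  by (simp add: dilatation_def matrix_vector_mul_assoc flip: matrix_mul_assoc)

lemma continuous_on_dilatation: "continuous_on U dilatation"
  unfolding dilatation_def
  by (intro continuous_on_matrix_matrix_mult continuous_on_matrix_inv continuous_on_jacobian_matrix
      holomorphic_h g invertible_jacobian_h)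

lemma has_derivative_perturbation:
  assumes "z \<in> U" "bounded_linear P"
  shows "((\<lambda>z. h z + P (g z)) has_derivative
    (\<lambda>v. jacobian_matrix h z *v v + P (dilatation z *v (jacobian_matrix h z *v v)))) (at z)"
  unfolding jacobian_g_eq[OF assms(1), symmetric]
  by (intro has_derivative_add bounded_linear.has_derivative[OF assms(2)]
      holomorphic_map_on_jacobian_matrix[OF g assms(1)]
      holomorphic_map_on_jacobian_matrix[OF holomorphic_h assms(1)])

context
  fixes P :: "complex^'n \<Rightarrow> complex^'n"
  assumes P: "bounded_linear P" and P_le: "\<And>v. norm (P v) \<le> norm v"
begin

lemma norm_perturbation_le:
  assumes "z \<in> U"
  shows "norm (s + P (dilatation z *v s)) \<le> (1 + C) * norm s"
  using norm_triangle_ineq[of s "P (dilatation z *v s)"] P_le[of "dilatation z *v s"]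
    norm_dilatation_mult_le[OF assms, of s]
  by (simp add: algebra_simps)

lemma norm_perturbation_ge:
  assumes "z \<in> U"
  shows "(1 - C) * norm s \<le> norm (s + P (dilatation z *v s))"
  using norm_diff_ineq[of s "P (dilatation z *v s)"] P_le[of "dilatation z *v s"]
    norm_dilatation_mult_le[OF assms, of s]
  by (simp add: algebra_simps)

lemma continuous_on_perturbation: "continuous_on U (\<lambda>z. h z + P (g z))"
  by (intro continuous_on_add bounded_linear.continuous_on[OF P]
      holomorphic_map_on_imp_continuous_on[OF g] holomorphic_map_on_imp_continuous_on[OF holomorphic_h])

text \<open>The differential is bounded below by \<open>1 - C\<close> times that of \<open>h\<close>, which is invertible.\<close>

lemma inj_derivative_perturbation:
  assumes "z \<in> U"
  shows "inj (\<lambda>v. jacobian_matrix h z *v v + P (dilatation z *v (jacobian_matrix h z *v v)))"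
proof -
  have lin: "linear (\<lambda>v. jacobian_matrix h z *v v + P (dilatation z *v (jacobian_matrix h z *v v)))"
    using has_derivative_perturbation[OF assms P] by (rule has_derivative_linear)
  have "v = 0" if "jacobian_matrix h z *v v + P (dilatation z *v (jacobian_matrix h z *v v)) = 0" for v
  proof -
    have "jacobian_matrix h z *v v = 0"
      using norm_perturbation_ge[OF assms, of "jacobian_matrix h z *v v", unfolded that] C_less_1
      by (auto simp: mult_le_0_iff)
    then show ?thesis
      using injD[OF inj_matrix_vector_mult[OF invertible_jacobian_h[OF assms]], of v 0] by simp
  qed
  then show ?thesis
    unfolding linear_injective_0[OF lin] by blast
qed

text \<open>Pulling a path back by the inverse of \<open>p = h + P \<circ> g\<close>. What is controlled is \<open>Dh(\<delta>) \<delta>'\<close>,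
which the bound on the dilatation compares with \<open>\<gamma>'\<close>; a bound on \<open>\<delta>'\<close> itself would need a uniform
lower bound on \<open>Dh\<close>.\<close>

lemma lift_path:
  assumes inj: "inj_on (\<lambda>z. h z + P (g z)) U"
    and \<gamma>: "valid_path \<gamma>" "path_image \<gamma> \<subseteq> (\<lambda>z. h z + P (g z)) ` U"
  obtains \<delta> S \<delta>' where "continuous_on {0..1} \<delta>" "\<delta> ` {0..1} \<subseteq> U"
    "\<forall>t\<in>{0..1}. h (\<delta> t) + P (g (\<delta> t)) = \<gamma> t" "finite S"
    "\<forall>t\<in>{0..1} - S. (\<delta> has_vector_derivative \<delta>' t) (at t)"
    "continuous_on ({0..1} - S) (\<lambda>t. jacobian_matrix h (\<delta> t) *v \<delta>' t)"
    "\<forall>t\<in>{0..1} - S.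
       (1 - C) * norm (jacobian_matrix h (\<delta> t) *v \<delta>' t) \<le> norm (vector_derivative \<gamma> (at t))"
proof -
  let ?p = "\<lambda>z. h z + P (g z)"
  define \<delta> where "\<delta> = the_inv_into U ?p \<circ> \<gamma>"
  obtain S where \<gamma>_cont: "continuous_on {0..1} \<gamma>" and S: "finite S"
    and C1: "\<gamma> C1_differentiable_on ({0..1} - S)"
    using \<gamma>(1) by (auto simp: valid_path_def piecewise_C1_differentiable_on_def)
  have diff: "\<gamma> differentiable (at t)" if "t \<in> {0..1} - S" for t
    using C1 that by (auto simp: C1_differentiable_on_eq)
  have \<gamma>': "continuous_on ({0..1} - S) (\<lambda>t. vector_derivative \<gamma> (at t))"
    using C1 by (simp add: C1_differentiable_on_eq)
  have \<gamma>_in: "\<gamma> t \<in> ?p ` U" if "t \<in> {0..1}" for t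
    using that \<gamma>(2) by (auto simp: path_image_def)
  have \<delta>_U: "\<delta> t \<in> U" if "t \<in> {0..1}" for t
    unfolding \<delta>_def comp_def by (rule the_inv_into_into[OF inj \<gamma>_in[OF that] order_refl])
  have p\<delta>: "?p (\<delta> t) = \<gamma> t" if "t \<in> {0..1}" for t
    unfolding \<delta>_def comp_def by (rule f_the_inv_into_f[OF inj \<gamma>_in[OF that]])
  have "continuous_on (?p ` U) (the_inv_into U ?p)"
    by (rule continuous_on_the_inv_into[OF open_U continuous_on_perturbation inj])
  then have \<delta>_cont: "continuous_on {0..1} \<delta>"
    unfolding \<delta>_def comp_def by (rule continuous_on_compose2[OF _ \<gamma>_cont]) (use \<gamma>_in in blast)
  define s where "s = (\<lambda>t v. jacobian_matrix h (\<delta> t) *v v)"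
  define \<delta>' where "\<delta>' = (\<lambda>t. vector_derivative \<delta> (at t))"
  have \<delta>': "(\<delta> has_vector_derivative \<delta>' t) (at t)"
    and eq: "s t (\<delta>' t) + P (dilatation (\<delta> t) *v s t (\<delta>' t)) = vector_derivative \<gamma> (at t)"
    if "t \<in> {0..1} - S" for t
  proof -
    define p' where "p' = (\<lambda>v. s t v + P (dilatation (\<delta> t) *v s t v))"
    have p': "(?p has_derivative p') (at (\<delta> t))" "inj p'"
      unfolding p'_def s_def using that \<delta>_U
      by (auto intro!: has_derivative_perturbation P inj_derivative_perturbation)
    then obtain R where R: "linear R" "\<And>v. R (p' v) = v" "\<And>v. p' (R v) = v"
      using linear_injective_isomorphism[OF has_derivative_linear[OF p'(1)]] by blast
    have "(the_inv_into U ?p has_derivative R) (at (?p (\<delta> t)))"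
      using that \<delta>_U p'(1) R by (intro has_derivative_the_inv_into[OF open_U continuous_on_perturbation inj])
        (auto simp: linear_linear fun_eq_iff)
    then have "(the_inv_into U ?p has_derivative R) (at (\<gamma> t))"
      using that p\<delta> by auto
    moreover have "(\<gamma> has_vector_derivative vector_derivative \<gamma> (at t)) (at t)"
      using diff[OF that] by (simp add: vector_derivative_works)
    ultimately have deriv: "(\<delta> has_vector_derivative R (vector_derivative \<gamma> (at t))) (at t)"
      unfolding \<delta>_def
      by (intro vector_derivative_diff_chain_within) (auto intro: has_derivative_at_withinI)
    then have \<delta>'_eq: "\<delta>' t = R (vector_derivative \<gamma> (at t))"
      unfolding \<delta>'_def by (rule vector_derivative_at)
    show "(\<delta> has_vector_derivative \<delta>' t) (at t)"
      using deriv by (simp only: \<delta>'_eq)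
    show "s t (\<delta>' t) + P (dilatation (\<delta> t) *v s t (\<delta>' t)) = vector_derivative \<gamma> (at t)"
      using R(3)[of "vector_derivative \<gamma> (at t)"] unfolding p'_def \<delta>'_eq .
  qed
  have \<omega>\<delta>: "continuous_on ({0..1} - S) (\<lambda>t. dilatation (\<delta> t))"
    using \<delta>_U by (intro continuous_on_compose2[OF continuous_on_dilatation] continuous_on_subset[OF \<delta>_cont]) auto
  have "continuous_on ({0..1} - S) (\<lambda>t. s t (\<delta>' t))"
    using continuous_on_solution_of_contractive_equation[OF P P_le \<omega>\<delta> _ C_less_1 \<gamma>' eq]
      norm_dilatation_mult_le \<delta>_U
    by auto
  moreover have "(1 - C) * norm (s t (\<delta>' t)) \<le> norm (vector_derivative \<gamma> (at t))" if "t \<in> {0..1} - S" for t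
    using norm_perturbation_ge[of "\<delta> t" "s t (\<delta>' t)"] that \<delta>_U eq by auto
  ultimately show ?thesis
    using \<delta>_U p\<delta> \<delta>' unfolding s_def
    by (intro that[OF \<delta>_cont _ _ S]) auto
qed

end

text \<open>The comparison of speeds: pulling a path back by one perturbation and pushing it forward by another
changes the length by at most the factor \<open>(1 + C) / (1 - C)\<close>, and on the way \<open>g\<close> moves by at most
\<open>C / (1 - C)\<close> times the length.\<close>

lemma transport_path:
  assumes P: "bounded_linear P" "\<And>v. norm (P v) \<le> norm v"
    and Q: "bounded_linear Q" "\<And>v. norm (Q v) \<le> norm v"
    and inj: "inj_on (\<lambda>z. h z + P (g z)) U"
    and \<gamma>: "has_path_length \<gamma> l" "path_image \<gamma> \<subseteq> (\<lambda>z. h z + P (g z)) ` U"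
      "pathstart \<gamma> = h z1 + P (g z1)" "pathfinish \<gamma> = h z2 + P (g z2)"
    and z: "z1 \<in> U" "z2 \<in> U"
  obtains \<beta> l' where "has_path_length \<beta> l'" "path_image \<beta> \<subseteq> (\<lambda>z. h z + Q (g z)) ` U"
      "pathstart \<beta> = h z1 + Q (g z1)" "pathfinish \<beta> = h z2 + Q (g z2)"
      "(1 - C) * l' \<le> (1 + C) * l" "(1 - C) * norm (g z1 - g z2) \<le> C * l"
proof -
  have speed: "((\<lambda>t. norm (vector_derivative \<gamma> (at t))) has_integral l) {0..1}" and "valid_path \<gamma>"
    using \<gamma>(1) by (auto simp: has_path_length_def)
  obtain \<delta> S \<delta>' where \<delta>: "continuous_on {0..1} \<delta>" and \<delta>_U: "\<delta> ` {0..1} \<subseteq> U"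
    and p\<delta>: "\<forall>t\<in>{0..1}. h (\<delta> t) + P (g (\<delta> t)) = \<gamma> t" and S: "finite S"
    and deriv: "\<forall>t\<in>{0..1} - S. (\<delta> has_vector_derivative \<delta>' t) (at t)"
    and s: "continuous_on ({0..1} - S) (\<lambda>t. jacobian_matrix h (\<delta> t) *v \<delta>' t)"
    and s_le: "\<forall>t\<in>{0..1} - S.
       (1 - C) * norm (jacobian_matrix h (\<delta> t) *v \<delta>' t) \<le> norm (vector_derivative \<gamma> (at t))"
    by (rule lift_path[OF P inj \<open>valid_path \<gamma>\<close> \<gamma>(2)])
  note \<delta>' = bspec[OF deriv]
  define s where "s t = jacobian_matrix h (\<delta> t) *v \<delta>' t" for t
  note s = s[folded s_def] and s_le = s_le[folded s_def, rule_format]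
  have C: "0 \<le> C" and C1: "0 < 1 - C"
    using C_nonneg z C_less_1 by auto
  have \<delta>_U': "\<delta> t \<in> U" if "t \<in> {0..1}" for t
    using \<delta>_U that by blast
  have \<delta>_ends: "\<delta> 0 = z1" "\<delta> 1 = z2"
    using bspec[OF p\<delta>, of 0] bspec[OF p\<delta>, of 1] \<gamma>(3,4) z \<delta>_U'[of 0] \<delta>_U'[of 1]
    by (auto simp: pathstart_def pathfinish_def intro: inj_onD[OF inj])
  have \<omega>\<delta>: "continuous_on ({0..1} - S) (\<lambda>t. dilatation (\<delta> t) *v s t)"
    using \<delta>_U
    by (intro continuous_on_matrix_vector_mult s continuous_on_compose2[OF continuous_on_dilatation]
        continuous_on_subset[OF \<delta>]) auto
  have scaled: "((\<lambda>t. K / (1 - C) * norm (vector_derivative \<gamma> (at t))) has_integral K / (1 - C) * l) {0..1}" for K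
    by (rule has_integral_mult_right[OF speed])
  have s_le': "K * norm (s t) \<le> K / (1 - C) * norm (vector_derivative \<gamma> (at t))"
    if "t \<in> {0..1} - S" "0 \<le> K" for t K
    using mult_left_mono[OF s_le[OF that(1)] that(2)] C1 by (simp add: field_simps)

  let ?q = "\<lambda>z. h z + Q (g z)"
  obtain l' where l': "has_path_length (\<lambda>t. ?q (\<delta> t)) l'" "l' \<le> (1 + C) / (1 - C) * l"
  proof (rule has_path_length_dominated[OF _ S _ _ _ scaled[of "1 + C"]])
    show "continuous_on {0..1} (\<lambda>t. ?q (\<delta> t))"
      by (rule continuous_on_compose2[OF continuous_on_perturbation[OF Q] \<delta> \<delta>_U])
    show "((\<lambda>t. ?q (\<delta> t)) has_vector_derivative s t + Q (dilatation (\<delta> t) *v s t)) (at t)"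
      if "t \<in> {0..1} - S" for t
      using vector_derivative_diff_chain_within[OF \<delta>'[OF that]
          has_derivative_at_withinI[OF has_derivative_perturbation[OF \<delta>_U' Q(1)]]] that
      by (simp add: s_def comp_def)
    show "continuous_on ({0..1} - S) (\<lambda>t. s t + Q (dilatation (\<delta> t) *v s t))"
      by (intro continuous_on_add s bounded_linear.continuous_on[OF Q(1)] \<omega>\<delta>)
    show "norm (s t + Q (dilatation (\<delta> t) *v s t)) \<le> (1 + C) / (1 - C) * norm (vector_derivative \<gamma> (at t))"
      if "t \<in> {0..1} - S" for t
      using norm_perturbation_le[OF Q \<delta>_U', of t "s t"] s_le'[OF that, of "1 + C"] that C by simp
  qed
  obtain lg where lg: "has_path_length (\<lambda>t. g (\<delta> t)) lg" "lg \<le> C / (1 - C) * l"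
  proof (rule has_path_length_dominated[OF _ S _ \<omega>\<delta> _ scaled[of C]])
    show "continuous_on {0..1} (\<lambda>t. g (\<delta> t))"
      by (rule continuous_on_compose2[OF holomorphic_map_on_imp_continuous_on[OF g] \<delta> \<delta>_U])
    show "((\<lambda>t. g (\<delta> t)) has_vector_derivative dilatation (\<delta> t) *v s t) (at t)" if "t \<in> {0..1} - S" for t
      using vector_derivative_diff_chain_within[OF \<delta>'[OF that]
          has_derivative_at_withinI[OF holomorphic_map_on_jacobian_matrix[OF g \<delta>_U']]] that
      by (simp add: s_def comp_def jacobian_g_eq \<delta>_U')
    show "norm (dilatation (\<delta> t) *v s t) \<le> C / (1 - C) * norm (vector_derivative \<gamma> (at t))"
      if "t \<in> {0..1} - S" for t
      using norm_dilatation_mult_le[OF \<delta>_U', of t "s t"] s_le'[OF that C] that by simp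
  qed
  show ?thesis
  proof (rule that[OF l'(1)])
    show "path_image (\<lambda>t. ?q (\<delta> t)) \<subseteq> ?q ` U"
      using \<delta>_U by (auto simp: path_image_def)
    show "(1 - C) * l' \<le> (1 + C) * l"
      using mult_left_mono[OF l'(2), of "1 - C"] C1 by simp
    have "norm (g z1 - g z2) \<le> C / (1 - C) * l"
      using dist_endpoints_le_path_length[OF lg(1)] lg(2) by (simp add: \<delta>_ends norm_minus_commute)
    then show "(1 - C) * norm (g z1 - g z2) \<le> C * l"
      using mult_left_mono[of "norm (g z1 - g z2)" "C / (1 - C) * l" "1 - C"] C1 by simp
  qed (auto simp: pathstart_def pathfinish_def \<delta>_ends)
qed

text \<open>The difference \<open>q - p = Q \<circ> g - P \<circ> g\<close> varies by at most \<open>2 C M / (1 - C)\<close> times the variation of \<open>p\<close>.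
The hypothesis \<open>C < 1 / (2 M + 1)\<close> says exactly that this factor is below \<open>1\<close>, so \<open>p\<close> is a Lipschitz
function of \<open>q\<close>.\<close>

lemma linearly_connected_perturbation:
  assumes P: "bounded_linear P" "\<And>v. norm (P v) \<le> norm v"
    and Q: "bounded_linear Q" "\<And>v. norm (Q v) \<le> norm v"
    and inj: "inj_on (\<lambda>z. h z + P (g z)) U"
    and lc: "linearly_connected M ((\<lambda>z. h z + P (g z)) ` U)"
    and C_less: "C < 1 / (2 * M + 1)"
  shows "inj_on (\<lambda>z. h z + Q (g z)) U"
    and "linearly_connected (M * (1 + C) / (1 - (1 + 2 * M) * C)) ((\<lambda>z. h z + Q (g z)) ` U)"
proof -
  let ?p = "\<lambda>z. h z + P (g z)" and ?q = "\<lambda>z. h z + Q (g z)"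
  define c where "c = 1 - (1 + 2 * M) * C"
  have M: "M > 0" and U: "U \<noteq> {}"
    using lc by (auto simp: linearly_connected_def)
  have C: "0 \<le> C" "0 < 1 - C" and c: "c > 0"
    using C_nonneg[OF U] C_less C_less_1 M by (simp_all add: c_def pos_less_divide_eq mult.commute add.commute)
  have joined: "\<exists>\<beta> l'. has_path_length \<beta> l' \<and> pathstart \<beta> = ?q z1 \<and> pathfinish \<beta> = ?q z2 \<and>
        path_image \<beta> \<subseteq> ?q ` U \<and> (1 - C) * l' \<le> (1 + C) * M * norm (?p z1 - ?p z2)"
    and lower: "c * norm (?p z1 - ?p z2) \<le> (1 - C) * norm (?q z1 - ?q z2)"
    if z: "z1 \<in> U" "z2 \<in> U" for z1 z2
  proof -
    let ?d = "norm (?p z1 - ?p z2)"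
    obtain \<gamma> l where \<gamma>: "has_path_length \<gamma> l" "path_image \<gamma> \<subseteq> ?p ` U" "pathstart \<gamma> = ?p z1"
        "pathfinish \<gamma> = ?p z2" and l: "l \<le> M * ?d"
      using lc z unfolding linearly_connected_def by blast
    obtain \<beta> l' where \<beta>: "has_path_length \<beta> l'" "path_image \<beta> \<subseteq> ?q ` U"
        "pathstart \<beta> = ?q z1" "pathfinish \<beta> = ?q z2"
      and l': "(1 - C) * l' \<le> (1 + C) * l" and gl: "(1 - C) * norm (g z1 - g z2) \<le> C * l"
      by (rule transport_path[OF P Q inj \<gamma> z])
    have "(1 + C) * l \<le> (1 + C) * M * ?d"
      using mult_left_mono[OF l, of "1 + C"] C by simp
    then show "\<exists>\<beta> l'. has_path_length \<beta> l' \<and> pathstart \<beta> = ?q z1 \<and> pathfinish \<beta> = ?q z2 \<and>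
        path_image \<beta> \<subseteq> ?q ` U \<and> (1 - C) * l' \<le> (1 + C) * M * ?d"
      using \<beta> l' by (meson order_trans)
    have triangle: "norm a \<le> norm (a - u + v) + norm u + norm v" for a u v :: "complex^'n"
      by norm
    have "?q z1 - ?q z2 = (?p z1 - ?p z2) - P (g z1 - g z2) + Q (g z1 - g z2)"
      by (simp add: linear_diff[OF bounded_linear.linear[OF P(1)]]
          linear_diff[OF bounded_linear.linear[OF Q(1)]])
    then have "?d \<le> norm (?q z1 - ?q z2) + norm (P (g z1 - g z2)) + norm (Q (g z1 - g z2))"
      by (simp only: triangle)
    then have "?d \<le> norm (?q z1 - ?q z2) + 2 * norm (g z1 - g z2)"
      using P(2)[of "g z1 - g z2"] Q(2)[of "g z1 - g z2"] by linarith
    then have "(1 - C) * ?d \<le> (1 - C) * norm (?q z1 - ?q z2) + 2 * ((1 - C) * norm (g z1 - g z2))"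
      using mult_left_mono[of ?d "norm (?q z1 - ?q z2) + 2 * norm (g z1 - g z2)" "1 - C"] C
      by (simp only: distrib_left mult.left_commute)
    moreover have "C * l \<le> C * (M * ?d)"
      using mult_left_mono[OF l C(1)] .
    ultimately have "(1 - C) * ?d \<le> (1 - C) * norm (?q z1 - ?q z2) + 2 * (C * (M * ?d))"
      using gl by linarith
    then show "c * ?d \<le> (1 - C) * norm (?q z1 - ?q z2)"
      by (simp add: c_def algebra_simps)
  qed
  show inj_q: "inj_on ?q U"
  proof (rule inj_onI)
    fix z1 z2 assume z: "z1 \<in> U" "z2 \<in> U" "?q z1 = ?q z2"
    then have "?p z1 = ?p z2"
      using lower[of z1 z2] c by (simp add: mult_le_0_iff)
    with inj z show "z1 = z2"
      by (auto dest: inj_onD)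
  qed
  show "linearly_connected (M * (1 + C) / (1 - (1 + 2 * M) * C)) (?q ` U)"
    unfolding linearly_connected_def c_def[symmetric]
  proof (intro conjI ballI)
    show "0 < M * (1 + C) / c"
      using M C c by simp
    show "open (?q ` U)"
      by (intro invariance_of_domain open_U inj_q continuous_on_perturbation Q)
    have "connected (?p ` U)"
      using lc by (simp add: linearly_connected_def)
    \<comment> \<open>Connectedness of \<open>U\<close> is inherited from the image under \<open>p\<close>.\<close>
    then have "connected (the_inv_into U ?p ` ?p ` U)"
      by (rule connected_continuous_image[OF
            continuous_on_the_inv_into[OF open_U continuous_on_perturbation[OF P] inj]])
    then show "connected (?q ` U)"
      unfolding the_inv_into_onto[OF inj]
      by (intro connected_continuous_image continuous_on_perturbation Q)
    show "?q ` U \<noteq> {}"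
      using U by simp
    fix w1 w2 assume "w1 \<in> ?q ` U" "w2 \<in> ?q ` U"
    then obtain z1 z2 where z: "z1 \<in> U" "z2 \<in> U" and w: "w1 = ?q z1" "w2 = ?q z2"
      by blast
    obtain \<beta> l' where \<beta>: "has_path_length \<beta> l'" "pathstart \<beta> = w1" "pathfinish \<beta> = w2"
        "path_image \<beta> \<subseteq> ?q ` U" and l': "(1 - C) * l' \<le> (1 + C) * M * norm (?p z1 - ?p z2)"
      using joined[OF z] unfolding w by blast
    have "c * ((1 - C) * l') \<le> (1 + C) * M * (c * norm (?p z1 - ?p z2))"
      using mult_left_mono[OF l', of c] c by (simp add: mult_ac)
    also have "\<dots> \<le> (1 + C) * M * ((1 - C) * norm (w1 - w2))"
      using lower[OF z] C M by (intro mult_left_mono) (auto simp: w)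
    finally have "(1 - C) * (c * l') \<le> (1 - C) * ((1 + C) * M * norm (w1 - w2))"
      by (simp only: mult_ac)
    then have "c * l' \<le> (1 + C) * M * norm (w1 - w2)"
      using C(2) by (simp only: mult_le_cancel_left_pos)
    then have "l' \<le> M * (1 + C) / c * norm (w1 - w2)"
      using c by (simp add: field_simps)
    with \<beta> show "\<exists>\<beta> l'. has_path_length \<beta> l' \<and> pathstart \<beta> = w1 \<and> pathfinish \<beta> = w2 \<and>
        path_image \<beta> \<subseteq> ?q ` U \<and> l' \<le> M * (1 + C) / c * norm (w1 - w2)"
      by blast
  qed
qed

text \<open>When \<open>Q\<close> is complex linear, so is the differential of \<open>q\<close>, and therefore its inverse, which is the
differential of the inverse map.\<close>

lemma biholomorphic_on_holomorphic_perturbation: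
  assumes A: "onorm ((*v) A) \<le> 1" and inj: "inj_on (\<lambda>z. h z + g z v* A) U"
  shows "biholomorphic_on (\<lambda>z. h z + g z v* A) U"
proof -
  let ?q = "\<lambda>z. h z + g z v* A"
  define K where "K = (\<lambda>z. jacobian_matrix h z + transpose A ** jacobian_matrix g z)"
  note Q = bounded_linear_vector_matrix_mult[of A] norm_vector_matrix_mult_contraction[OF A]
  have K: "(*v) (K z) =
      (\<lambda>v. jacobian_matrix h z *v v + (dilatation z *v (jacobian_matrix h z *v v)) v* A)" if "z \<in> U" for z
    by (simp add: K_def fun_eq_iff matrix_vector_mult_add_rdistrib jacobian_g_eq[OF that]
        flip: matrix_vector_mul_assoc)
  have deriv: "(?q has_derivative (*v) (K z)) (at z)" if "z \<in> U" for z
    unfolding K[OF that] by (rule has_derivative_perturbation[OF that Q(1)])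
  have inv: "invertible (K z)" if "z \<in> U" for z
    using inj_derivative_perturbation[OF Q that]
    by (simp add: invertible_left_inverse matrix_left_invertible_injective K[OF that])
  have "(the_inv_into U ?q has_derivative (*v) (matrix_inv (K z))) (at (?q z))" if "z \<in> U" for z
    using matrix_inv_works[OF inv[OF that]]
    by (intro has_derivative_the_inv_into[OF open_U continuous_on_perturbation[OF Q] inj that deriv[OF that]])
      (auto simp: fun_eq_iff matrix_vector_mul_assoc)
  then have "holomorphic_map_on (the_inv_into U ?q) (?q ` U)"
    unfolding holomorphic_map_on_def
    using invariance_of_domain[OF continuous_on_perturbation[OF Q] open_U inj] by blast
  moreover have "holomorphic_map_on ?q U"
    using deriv open_U by (auto simp: holomorphic_map_on_def)
  ultimately show ?thesis
    using inj by (simp add: biholomorphic_on_def)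
qed

end

section \<open>Stability of univalence and linear connectivity\<close>

lemma small_dilatation_if_C_small:
  assumes "locally_biholomorphic_on h U" "holomorphic_map_on g U"
    and "\<forall>z\<in>U. onorm ((*v) (jacobian_matrix g z ** matrix_inv (jacobian_matrix h z))) \<le> C"
    and "C < 1 / (2 * M + 1)" "M > 0"
  shows "small_dilatation h g U C"
proof
  have "1 / (2 * M + 1) < 1"
    using \<open>M > 0\<close> by simp
  then show "C < 1"
    using assms(4) by linarith
qed (use assms(1-3) in auto)

lemma contraction_cnj_vec_matrix:
  fixes A :: "complex^'n^'m"
  assumes "onorm ((*v) A) \<le> 1"
  shows "bounded_linear (\<lambda>v. cnj_vec v v* A)" "norm (cnj_vec v v* A) \<le> norm v"
  using bounded_linear_compose[OF bounded_linear_vector_matrix_mult bounded_linear_cnj_vec]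
    norm_vector_matrix_mult_contraction[OF assms, of "cnj_vec v"]
  by (simp_all add: norm_cnj_vec)

lemma contraction_minus_matrix:
  fixes A :: "complex^'n^'m"
  assumes "onorm ((*v) A) \<le> 1"
  shows "bounded_linear (\<lambda>v. - (v v* A))" "norm (- (v v* A)) \<le> norm v"
  using bounded_linear_minus[OF bounded_linear_vector_matrix_mult]
    norm_vector_matrix_mult_contraction[OF assms]
  by simp_all

theorem theorem2:
  fixes f F h g :: "complex^'n \<Rightarrow> complex^'n" and M C :: real
  assumes "pluriharmonic_on f (ball 0 1)"
    and "\<forall>z\<in>ball 0 1. f z = h z + cnj_vec (g z)"
    and "\<forall>z\<in>ball 0 1. F z = h z - g z"
    and "locally_biholomorphic_on h (ball 0 1)"
    and "holomorphic_map_on g (ball 0 1)"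
    and "M > 0"
  shows
    "(biholomorphic_on F (ball 0 1) \<and>
      linearly_connected M (F ` ball 0 1) \<and>
      (\<forall>z\<in>ball 0 1.
         onorm ((*v) (jacobian_matrix g z ** matrix_inv (jacobian_matrix h z))) \<le> C) \<and>
      C < 1 / (2 * M + 1)
      \<longrightarrow>
      (\<forall>A :: complex^'n^'n. onorm ((*v) A) \<le> 1 \<longrightarrow>
         inj_on (\<lambda>z. h z + cnj_vec (g z) v* A) (ball 0 1) \<and>
         linearly_connected (M * (1 + C) / (1 - (1 + 2 * M) * C))
           ((\<lambda>z. h z + cnj_vec (g z) v* A) ` ball 0 1)) \<and>
      stable_biholomorphic h g)
     \<and>
     (inj_on f (ball 0 1) \<and>
      linearly_connected M (f ` ball 0 1) \<and>
      (\<forall>z\<in>ball 0 1.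
         onorm ((*v) (jacobian_matrix g z ** matrix_inv (jacobian_matrix h z))) \<le> C) \<and>
      C < 1 / (2 * M + 1)
      \<longrightarrow>
      (\<forall>A :: complex^'n^'n. onorm ((*v) A) \<le> 1 \<longrightarrow>
         inj_on (\<lambda>z. h z - g z v* A) (ball 0 1) \<and>
         linearly_connected (M * (1 + C) / (1 - (1 + 2 * M) * C))
           ((\<lambda>z. h z - g z v* A) ` ball 0 1)) \<and>
      stable_pluriharmonic_univalent h g)"
proof (rule conjI; rule impI; elim conjE)
  assume F: "biholomorphic_on F (ball 0 1)" "linearly_connected M (F ` ball 0 1)"
    and dil: "\<forall>z\<in>ball 0 1.
         onorm ((*v) (jacobian_matrix g z ** matrix_inv (jacobian_matrix h z))) \<le> C"
    and C: "C < 1 / (2 * M + 1)"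
  interpret small_dilatation h g "ball 0 1" C
    by (rule small_dilatation_if_C_small[OF assms(4,5) dil C \<open>M > 0\<close>])
  have F_eq: "F z = h z + - g z" if "z \<in> ball 0 1" for z
    using assms(3) that by simp
  have P: "bounded_linear (uminus :: complex^'n \<Rightarrow> complex^'n)"
      "\<And>v :: complex^'n. norm (- v) \<le> norm v"
    by (simp_all add: bounded_linear_minus bounded_linear_ident)
  have inj: "inj_on (\<lambda>z. h z + - g z) (ball 0 1)"
    using F(1) inj_on_cong[of "ball 0 1" F, OF F_eq] by (simp only: biholomorphic_on_def)
  have lc: "linearly_connected M ((\<lambda>z. h z + - g z) ` ball 0 1)"
  proof -
    have "F ` ball 0 1 = (\<lambda>z. h z + - g z) ` ball 0 1"
      by (rule image_cong[OF refl F_eq])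
    with F(2) show ?thesis by (simp only:)
  qed
  show "(\<forall>A :: complex^'n^'n. onorm ((*v) A) \<le> 1 \<longrightarrow>
         inj_on (\<lambda>z. h z + cnj_vec (g z) v* A) (ball 0 1) \<and>
         linearly_connected (M * (1 + C) / (1 - (1 + 2 * M) * C))
           ((\<lambda>z. h z + cnj_vec (g z) v* A) ` ball 0 1)) \<and>
      stable_biholomorphic h g"
    unfolding stable_biholomorphic_def
  proof (intro conjI allI impI)
    fix A :: "complex^'n^'n" assume A: "onorm ((*v) A) \<le> 1"
    show "inj_on (\<lambda>z. h z + cnj_vec (g z) v* A) (ball 0 1)"
      "linearly_connected (M * (1 + C) / (1 - (1 + 2 * M) * C))
           ((\<lambda>z. h z + cnj_vec (g z) v* A) ` ball 0 1)"
      by (rule linearly_connected_perturbation[OF P contraction_cnj_vec_matrix[OF A] inj lc C])+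
  next
    fix A :: "complex^'n^'n" assume "onorm ((*v) A) = 1"
    then have A: "onorm ((*v) A) \<le> 1" by simp
    show "biholomorphic_on (\<lambda>z. h z + g z v* A) (ball 0 1)"
      by (rule biholomorphic_on_holomorphic_perturbation[OF A
            linearly_connected_perturbation(1)[OF P bounded_linear_vector_matrix_mult
              norm_vector_matrix_mult_contraction[OF A] inj lc C]])
  qed
next
  assume f: "inj_on f (ball 0 1)" "linearly_connected M (f ` ball 0 1)"
    and dil: "\<forall>z\<in>ball 0 1.
         onorm ((*v) (jacobian_matrix g z ** matrix_inv (jacobian_matrix h z))) \<le> C"
    and C: "C < 1 / (2 * M + 1)"
  interpret small_dilatation h g "ball 0 1" C
    by (rule small_dilatation_if_C_small[OF assms(4,5) dil C \<open>M > 0\<close>])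
  have f_eq: "f z = h z + cnj_vec (g z)" if "z \<in> ball 0 1" for z
    using assms(2) that by simp
  have P: "bounded_linear cnj_vec" "\<And>v :: complex^'n. norm (cnj_vec v) \<le> norm v"
    by (simp_all add: bounded_linear_cnj_vec norm_cnj_vec)
  have inj: "inj_on (\<lambda>z. h z + cnj_vec (g z)) (ball 0 1)"
    using f(1) inj_on_cong[of "ball 0 1" f, OF f_eq] by (simp only:)
  have lc: "linearly_connected M ((\<lambda>z. h z + cnj_vec (g z)) ` ball 0 1)"
  proof -
    have "f ` ball 0 1 = (\<lambda>z. h z + cnj_vec (g z)) ` ball 0 1"
      by (rule image_cong[OF refl f_eq])
    with f(2) show ?thesis by (simp only:)
  qed
  show "(\<forall>A :: complex^'n^'n. onorm ((*v) A) \<le> 1 \<longrightarrow>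
         inj_on (\<lambda>z. h z - g z v* A) (ball 0 1) \<and>
         linearly_connected (M * (1 + C) / (1 - (1 + 2 * M) * C))
           ((\<lambda>z. h z - g z v* A) ` ball 0 1)) \<and>
      stable_pluriharmonic_univalent h g"
    unfolding stable_pluriharmonic_univalent_def diff_conv_add_uminus[where a = "h _"]
  proof (intro conjI allI impI)
    fix A :: "complex^'n^'n" assume A: "onorm ((*v) A) \<le> 1"
    show "inj_on (\<lambda>z. h z + - (g z v* A)) (ball 0 1)"
      "linearly_connected (M * (1 + C) / (1 - (1 + 2 * M) * C))
           ((\<lambda>z. h z + - (g z v* A)) ` ball 0 1)"
      by (rule linearly_connected_perturbation[OF P contraction_minus_matrix[OF A] inj lc C])+
  next
    fix A :: "complex^'n^'n" assume "onorm ((*v) A) = 1"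
    then have A: "onorm ((*v) A) \<le> 1" by simp
    show "inj_on (\<lambda>z. h z + cnj_vec (g z) v* A) (ball 0 1)"
      by (rule linearly_connected_perturbation(1)[OF P contraction_cnj_vec_matrix[OF A] inj lc C])
  qed
qed

end
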